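(* Let $G$ be a $\overline{C}$-group, with a fixed $\overline{C}$-type presentation $\Pi$. Then the homomorphism $$\pi\times\mathrm{Ab}_{\mathrm{f}}\colon G^{\mathcal{D}}\to G\times\mathbb{Z}^{\mathfrak{C}_{\mathrm{fg}}(G)}$$ is injective.
   Context: A $\overline{C}$-group is a group $G$ admitting a presentation $\Pi$ (a $\overline{C}$-type presentation), with some generator set $\Gamma$, in which every relation is either a conjugation relation $b^{-1}ab=c$ with $a,b,c\in\Gamma$, or a power relation $a^k=1$ with $a\in\Gamma$, $k\ge 2$; there is at most one power relation per conjugacy class of $G$ (i.e., for each conjugacy class $\mathcal{O}$ of $G$, at most one power relation $a^k=1$ has $a\in\mathcal{O}$). $\mathfrak{C}_{\mathrm{g}}(G)$ is the set of conjugacy classes of $G$ containing some generator from $\Gamma$; it is the disjoint union of $\mathfrak{C}_{\mathrm{fg}}(G)$ (classes whose elements have finite order) and $\mathfrak{C}_{\mathrm{ig}}(G)$ (classes whose elements have infinite order). For a set $X$, $\mathbb{Z}^X$ is the free abelian group with basis $(c_x)_{x\in X}$ (direct sum). The Dehn quandle $\Gamma^G$ is the union of the $G$-conjugacy classes of the elements of $\Gamma$, with $a\triangleleft b=b^{-1}ab$, and $G^{\mathcal{D}}=\langle e_a,\ a\in\Gamma^G\mid e_ae_b=e_be_{a\triangleleft b},\ a,b\in\Gamma^G\rangle$. The map $\pi\colon G^{\mathcal{D}}\to G$ is $e_a\mapsto a$. The map $\mathrm{Ab}_{\mathrm{f}}\colon G^{\mathcal{D}}\to\mathbb{Z}^{\mathfrak{C}_{\mathrm{fg}}(G)}$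 is the composition of the abelianisation map $G^{\mathcal{D}}\to\mathbb{Z}^{\mathfrak{C}_{\mathrm{g}}(G)}=\mathbb{Z}^{\mathfrak{C}_{\mathrm{fg}}(G)}\oplus\mathbb{Z}^{\mathfrak{C}_{\mathrm{ig}}(G)}$ (sending $e_a$ to $c_{\mathcal{O}}$ for $a\in\mathcal{O}$) with the projection onto $\mathbb{Z}^{\mathfrak{C}_{\mathrm{fg}}(G)}$. *)

theory Defs
  imports "HOL-Algebra.Free_Abelian_Groups" "HOL-Algebra.Multiplicative_Group"
begin

text \<open>The letter \<open>(x, True)\<close> stands for the generator \<open>x\<close>, the letter \<open>(x, False)\<close> for its formal
  inverse. A relation \<open>u = v\<close> is the pair of words \<open>(u, v)\<close>.\<close>

type_synonym 'x word = "('x \<times> bool) list"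

definition words :: "'x set \<Rightarrow> 'x word set" where
  "words X = lists (X \<times> UNIV)"

inductive word_cong :: "'x set \<Rightarrow> ('x word \<times> 'x word) set \<Rightarrow> 'x word \<Rightarrow> 'x word \<Rightarrow> bool"
  for X :: "'x set" and R :: "('x word \<times> 'x word) set" where
  refl: "w \<in> words X \<Longrightarrow> word_cong X R w w"
| sym: "word_cong X R u v \<Longrightarrow> word_cong X R v u"
| trans: "word_cong X R u v \<Longrightarrow> word_cong X R v w \<Longrightarrow> word_cong X R u w"
| app: "word_cong X R u v \<Longrightarrow> word_cong X R u' v' \<Longrightarrow> word_cong X R (u @ u') (v @ v')"
| cancel: "x \<in> X \<Longrightarrow> word_cong X R [(x, b), (x, \<not> b)] []"
| rel: "(u, v) \<in> R \<Longrightarrow> u \<in> words X \<Longrightarrow> v \<in> words X \<Longrightarrow> word_cong X R u v"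

definition word_class :: "'x set \<Rightarrow> ('x word \<times> 'x word) set \<Rightarrow> 'x word \<Rightarrow> 'x word set" where
  "word_class X R w = {v. word_cong X R w v}"

definition presented_group ::
    "'x set \<Rightarrow> ('x word \<times> 'x word) set \<Rightarrow> 'x word set monoid" where
  "presented_group X R =
     \<lparr>carrier = word_class X R ` words X,
      monoid.mult = (\<lambda>A B. \<Union>u\<in>A. \<Union>v\<in>B. word_class X R (u @ v)),
      one = word_class X R []\<rparr>"

definition word_eval :: "('g, 'm) monoid_scheme \<Rightarrow> ('x \<Rightarrow> 'g) \<Rightarrow> 'x word \<Rightarrow> 'g" where
  "word_eval H f w =
     foldr (\<lambda>(x, b) h. (if b then f x else inv\<^bsub>H\<^esub> f x) \<otimes>\<^bsub>H\<^esub> h) w \<one>\<^bsub>H\<^esub>"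

text \<open>The homomorphism \<open>presented_group X R \<rightarrow> H\<close> extending \<open>f\<close> on generators; it is only meaningful if \<open>f\<close>
  respects the relations, since otherwise \<open>word_eval H f\<close> is not constant on classes.\<close>

definition presented_lift :: "('g, 'm) monoid_scheme \<Rightarrow> ('x \<Rightarrow> 'g) \<Rightarrow> 'x word set \<Rightarrow> 'g" where
  "presented_lift H f A = the_elem (word_eval H f ` A)"

text \<open>Generators are formal symbols, interpreted in \<open>G\<close> by \<open>\<gamma>\<close>; distinct symbols are allowed to have
  the same value in \<open>G\<close>.\<close>

definition is_presentation ::
    "('g, 'm) monoid_scheme \<Rightarrow> 'x set \<Rightarrow> ('x \<Rightarrow> 'g) \<Rightarrow> ('x word \<times> 'x word) set \<Rightarrow> bool" where
  "is_presentation G X \<gamma> R \<longleftrightarrow>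
     \<gamma> \<in> X \<rightarrow> carrier G \<and>
     R \<subseteq> words X \<times> words X \<and>
     (\<forall>(u, v)\<in>R. word_eval G \<gamma> u = word_eval G \<gamma> v) \<and>
     presented_lift G \<gamma> \<in> iso (presented_group X R) G"

definition conj_op :: "('g, 'm) monoid_scheme \<Rightarrow> 'g \<Rightarrow> 'g \<Rightarrow> 'g" where
  "conj_op G a b = inv\<^bsub>G\<^esub> b \<otimes>\<^bsub>G\<^esub> a \<otimes>\<^bsub>G\<^esub> b"

definition conj_class :: "('g, 'm) monoid_scheme \<Rightarrow> 'g \<Rightarrow> 'g set" where
  "conj_class G a = conj_op G a ` carrier G"

definition conj_classes :: "('g, 'm) monoid_scheme \<Rightarrow> 'g set set" where
  "conj_classes G = conj_class G ` carrier G"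

definition conj_rel :: "'x \<Rightarrow> 'x \<Rightarrow> 'x \<Rightarrow> 'x word \<times> 'x word" where
  "conj_rel a b c = ([(b, False), (a, True), (b, True)], [(c, True)])"

definition power_rel :: "'x \<Rightarrow> nat \<Rightarrow> 'x word \<times> 'x word" where
  "power_rel a k = (replicate k (a, True), [])"

definition Cbar_presentation ::
    "('g, 'm) monoid_scheme \<Rightarrow> 'x set \<Rightarrow> ('x \<Rightarrow> 'g) \<Rightarrow> ('x word \<times> 'x word) set \<Rightarrow> bool" where
  "Cbar_presentation G X \<gamma> R \<longleftrightarrow>
     is_presentation G X \<gamma> R \<and>
     (\<forall>r\<in>R. (\<exists>a\<in>X. \<exists>b\<in>X. \<exists>c\<in>X. r = conj_rel a b c) \<or> (\<exists>a\<in>X. \<exists>k\<ge>2. r = power_rel a k)) \<and>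
     (\<forall>\<O>\<in>conj_classes G. \<exists>\<^sub>\<le>\<^sub>1r. r \<in> R \<and> (\<exists>a\<in>X. \<exists>k\<ge>2. r = power_rel a k \<and> \<gamma> a \<in> \<O>))"

text \<open>\<open>\<CC>\<^sub>g(G)\<close>, \<open>\<CC>\<^sub>f\<^sub>g(G)\<close> and \<open>\<CC>\<^sub>i\<^sub>g(G)\<close> for a set \<open>\<Gamma>\<close> of elements of \<open>G\<close>. In the library, elements of
  infinite order have \<open>ord\<close> equal to 0.\<close>

definition gen_classes :: "('g, 'm) monoid_scheme \<Rightarrow> 'g set \<Rightarrow> 'g set set" where
  "gen_classes G \<Gamma> = {\<O> \<in> conj_classes G. \<O> \<inter> \<Gamma> \<noteq> {}}"

definition fin_gen_classes :: "('g, 'm) monoid_scheme \<Rightarrow> 'g set \<Rightarrow> 'g set set" where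
  "fin_gen_classes G \<Gamma> = {\<O> \<in> gen_classes G \<Gamma>. \<forall>a\<in>\<O>. group.ord G a \<noteq> 0}"

definition inf_gen_classes :: "('g, 'm) monoid_scheme \<Rightarrow> 'g set \<Rightarrow> 'g set set" where
  "inf_gen_classes G \<Gamma> = {\<O> \<in> gen_classes G \<Gamma>. \<forall>a\<in>\<O>. group.ord G a = 0}"

definition dehn_quandle :: "('g, 'm) monoid_scheme \<Rightarrow> 'g set \<Rightarrow> 'g set" where
  "dehn_quandle G \<Gamma> = (\<Union>a\<in>\<Gamma>. conj_class G a)"

definition dehn_rels :: "('g, 'm) monoid_scheme \<Rightarrow> 'g set \<Rightarrow> ('g word \<times> 'g word) set" where
  "dehn_rels G \<Gamma> =
     {([(a, True), (b, True)], [(b, True), (conj_op G a b, True)]) | a b.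
        a \<in> dehn_quandle G \<Gamma> \<and> b \<in> dehn_quandle G \<Gamma>}"

definition dehn_group :: "('g, 'm) monoid_scheme \<Rightarrow> 'g set \<Rightarrow> 'g word set monoid" where
  "dehn_group G \<Gamma> = presented_group (dehn_quandle G \<Gamma>) (dehn_rels G \<Gamma>)"

definition dehn_gen :: "('g, 'm) monoid_scheme \<Rightarrow> 'g set \<Rightarrow> 'g \<Rightarrow> 'g word set" where
  "dehn_gen G \<Gamma> a = word_class (dehn_quandle G \<Gamma>) (dehn_rels G \<Gamma>) [(a, True)]"

definition dehn_proj :: "('g, 'm) monoid_scheme \<Rightarrow> 'g word set \<Rightarrow> 'g" where
  "dehn_proj G = presented_lift G (\<lambda>a. a)"

definition dehn_ab :: "('g, 'm) monoid_scheme \<Rightarrow> 'g set \<Rightarrow> 'g word set \<Rightarrow> ('g set \<Rightarrow>\<^sub>0 int)" where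
  "dehn_ab G \<Gamma> =
     presented_lift (free_Abelian_group (gen_classes G \<Gamma>)) (\<lambda>a. frag_of (conj_class G a))"

definition fin_proj :: "('g, 'm) monoid_scheme \<Rightarrow> 'g set \<Rightarrow> ('g set \<Rightarrow>\<^sub>0 int) \<Rightarrow> ('g set \<Rightarrow>\<^sub>0 int)" where
  "fin_proj G \<Gamma> = frag_extend (\<lambda>\<O>. if \<O> \<in> fin_gen_classes G \<Gamma> then frag_of \<O> else 0)"

definition dehn_ab_fin ::
    "('g, 'm) monoid_scheme \<Rightarrow> 'g set \<Rightarrow> 'g word set \<Rightarrow> ('g set \<Rightarrow>\<^sub>0 int)" where
  "dehn_ab_fin G \<Gamma> = fin_proj G \<Gamma> \<circ> dehn_ab G \<Gamma>"

lemma words_simps [simp]: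
  "[] \<in> words X" "(x, b) # w \<in> words X \<longleftrightarrow> x \<in> X \<and> w \<in> words X"
  "u @ v \<in> words X \<longleftrightarrow> u \<in> words X \<and> v \<in> words X"
  by (auto simp: words_def)

lemma word_cong_words:
  assumes "word_cong X R u v" shows "u \<in> words X \<and> v \<in> words X"
  using assms by induction auto

lemma word_class_eq_iff:
  assumes "u \<in> words X"
  shows "word_class X R u = word_class X R v \<longleftrightarrow> word_cong X R u v"
  using assms unfolding word_class_def
  by (auto intro: word_cong.refl word_cong.sym word_cong.trans)

lemma presented_mult:
  assumes "u \<in> words X" "v \<in> words X"
  shows "word_class X R u \<otimes>\<^bsub>presented_group X R\<^esub> word_class X R v = word_class X R (u @ v)"
proof -
  have "word_class X R (u' @ v') = word_class X R (u @ v)"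
    if "u' \<in> word_class X R u" "v' \<in> word_class X R v" for u' v'
    using that assms word_class_eq_iff[of "u @ v" X R "u' @ v'"]
    by (simp add: word_class_def word_cong.app)
  moreover have "u \<in> word_class X R u" "v \<in> word_class X R v"
    using assms by (auto simp: word_class_def intro: word_cong.refl)
  ultimately have "(\<Union>u'\<in>word_class X R u. \<Union>v'\<in>word_class X R v. word_class X R (u' @ v'))
      = word_class X R (u @ v)"
    by blast
  then show ?thesis by (simp add: presented_group_def)
qed

definition word_inv :: "'x word \<Rightarrow> 'x word" where
  "word_inv w = rev (map (\<lambda>(x, b). (x, \<not> b)) w)"

lemma word_inv_words: "w \<in> words X \<Longrightarrow> word_inv w \<in> words X"
  by (induction w) (auto simp: word_inv_def)

lemma word_inv_left:
  assumes "w \<in> words X" shows "word_cong X R (word_inv w @ w) []"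
  using assms
proof (induction w)
  case Nil
  then show ?case by (simp add: word_inv_def word_cong.refl)
next
  case (Cons p w)
  obtain x b where p: "p = (x, b)" by (cases p)
  have w: "w \<in> words X" "x \<in> X" using Cons.prems p by auto
  have c: "word_cong X R [(x, \<not> b), (x, b)] []"
    using word_cong.cancel[of x X R "\<not> b"] w by simp
  have "word_cong X R (word_inv w @ ([(x, \<not> b), (x, b)] @ w)) (word_inv w @ ([] @ w))"
    using w c by (intro word_cong.app word_cong.refl word_inv_words)
  then show ?case
    using Cons.IH[OF w(1)] p by (auto simp: word_inv_def intro: word_cong.trans)
qed

lemma presented_carrier: "carrier (presented_group X R) = word_class X R ` words X"
  by (simp add: presented_group_def)

lemma presented_one: "\<one>\<^bsub>presented_group X R\<^esub> = word_class X R []"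
  by (simp add: presented_group_def)

lemma presented_group_group: "group (presented_group X R)"
proof (rule groupI)
  show "\<exists>y\<in>carrier (presented_group X R). y \<otimes>\<^bsub>presented_group X R\<^esub> x = \<one>\<^bsub>presented_group X R\<^esub>"
    if x: "x \<in> carrier (presented_group X R)" for x
  proof -
    obtain w where w: "w \<in> words X" "x = word_class X R w"
      using x by (auto simp: presented_carrier)
    have "word_class X R (word_inv w @ w) = word_class X R []"
      using w word_inv_left[OF w(1)] word_inv_words[OF w(1)] by (simp add: word_class_eq_iff)
    then show ?thesis
      using w word_inv_words[OF w(1)]
      by (intro bexI[of _ "word_class X R (word_inv w)"])
         (auto simp: presented_mult presented_one presented_carrier)
  qed
qed (auto simp: presented_carrier presented_one presented_mult)

context group
begin

lemma word_eval_closed: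
  "f \<in> X \<rightarrow> carrier G \<Longrightarrow> w \<in> words X \<Longrightarrow> word_eval G f w \<in> carrier G"
  by (induction w) (auto simp: word_eval_def Pi_iff)

lemma word_eval_append:
  assumes "f \<in> X \<rightarrow> carrier G" "u \<in> words X" "v \<in> words X"
  shows "word_eval G f (u @ v) = word_eval G f u \<otimes> word_eval G f v"
  using assms(2)
proof (induction u)
  case Nil
  then show ?case using word_eval_closed[OF assms(1,3)] by (simp add: word_eval_def)
next
  case (Cons p u)
  obtain x b where p: "p = (x, b)" by (cases p)
  have "x \<in> X" "u \<in> words X" using Cons.prems p by auto
  then show ?case
    using Cons.IH p assms(1) word_eval_closed[OF assms(1,3)] word_eval_closed[OF assms(1) \<open>u \<in> words X\<close>]
    by (auto simp: word_eval_def m_assoc Pi_iff)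
qed

lemma word_eval_cong:
  assumes "word_cong X R u v" "f \<in> X \<rightarrow> carrier G"
    and "\<And>u v. (u, v) \<in> R \<Longrightarrow> word_eval G f u = word_eval G f v"
  shows "word_eval G f u = word_eval G f v"
  using assms(1)
proof induction
  case (app u v u' v')
  then show ?case
    using word_eval_append[OF assms(2)] word_cong_words[OF app(1)] word_cong_words[OF app(2)]
    by simp
next
  case (cancel x b)
  then show ?case using assms(2) by (auto simp: word_eval_def Pi_iff)
qed (use assms(3) in auto)

lemma presented_lift_word_class:
  assumes "f \<in> X \<rightarrow> carrier G" "\<And>u v. (u, v) \<in> R \<Longrightarrow> word_eval G f u = word_eval G f v"
    and "w \<in> words X"
  shows "presented_lift G f (word_class X R w) = word_eval G f w"
proof -
  have "word_eval G f ` word_class X R w = {word_eval G f w}"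
  proof (intro equalityI subsetI)
    fix y assume "y \<in> word_eval G f ` word_class X R w"
    then obtain v where v: "word_cong X R w v" "y = word_eval G f v"
      by (auto simp: word_class_def)
    have "word_eval G f w = word_eval G f v"
      by (rule word_eval_cong[OF v(1) assms(1)]) (rule assms(2))
    then show "y \<in> {word_eval G f w}" using v by simp
  next
    fix y assume "y \<in> {word_eval G f w}"
    moreover have "w \<in> word_class X R w"
      using assms(3) by (simp add: word_class_def word_cong.refl)
    ultimately show "y \<in> word_eval G f ` word_class X R w" by simp
  qed
  then show ?thesis by (simp add: presented_lift_def)
qed

lemma presented_lift_hom:
  assumes "f \<in> X \<rightarrow> carrier G" "\<And>u v. (u, v) \<in> R \<Longrightarrow> word_eval G f u = word_eval G f v"
  shows "presented_lift G f \<in> hom (presented_group X R) G"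
  by (rule homI)
     (auto simp: presented_carrier presented_mult presented_lift_word_class[OF assms]
        word_eval_append[OF assms(1)] word_eval_closed[OF assms(1)])

lemma conj_op_closed:
  "a \<in> carrier G \<Longrightarrow> b \<in> carrier G \<Longrightarrow> conj_op G a b \<in> carrier G"
  by (simp add: conj_op_def)

lemma conj_op_conj_op:
  assumes "a \<in> carrier G" "b \<in> carrier G" "c \<in> carrier G"
  shows "conj_op G (conj_op G a b) c = conj_op G a (b \<otimes> c)"
  using assms by (simp add: conj_op_def m_assoc inv_mult_group)

lemma conj_class_self: "a \<in> carrier G \<Longrightarrow> a \<in> conj_class G a"
  unfolding conj_class_def by (rule image_eqI[of _ _ \<one>]) (auto simp: conj_op_def)

lemma conj_class_conj_op:
  assumes "a \<in> carrier G" "b \<in> carrier G"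
  shows "conj_class G (conj_op G a b) = conj_class G a"
proof -
  have sub: "conj_class G (conj_op G a b) \<subseteq> conj_class G a"
    if "a \<in> carrier G" "b \<in> carrier G" for a b
    using that by (auto simp: conj_class_def conj_op_conj_op)
  have "conj_op G (conj_op G a b) (inv b) = a"
    using assms by (simp add: conj_op_conj_op) (simp add: conj_op_def)
  then show ?thesis
    using sub[OF assms] sub[OF conj_op_closed[OF assms], of "inv b"] assms by auto
qed

lemma dehn_quandle_carrier: "\<Gamma> \<subseteq> carrier G \<Longrightarrow> dehn_quandle G \<Gamma> \<subseteq> carrier G"
  by (auto simp: dehn_quandle_def conj_class_def conj_op_closed)

lemma dehn_quandle_conj_op:
  assumes "\<Gamma> \<subseteq> carrier G" "a \<in> dehn_quandle G \<Gamma>" "b \<in> carrier G"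
  shows "conj_op G a b \<in> dehn_quandle G \<Gamma>"
  using assms by (fastforce simp: dehn_quandle_def conj_class_def conj_op_conj_op)

lemma conj_class_gen_classes:
  assumes "\<Gamma> \<subseteq> carrier G" "a \<in> dehn_quandle G \<Gamma>"
  shows "conj_class G a \<in> gen_classes G \<Gamma>"
proof -
  obtain x g where x: "x \<in> \<Gamma>" "g \<in> carrier G" "a = conj_op G x g"
    using assms by (auto simp: dehn_quandle_def conj_class_def)
  then have "conj_class G a = conj_class G x" "x \<in> carrier G"
    using assms conj_class_conj_op by auto
  then show ?thesis
    using x conj_class_self by (auto simp: gen_classes_def conj_classes_def)
qed

lemma ord_conj_op:
  assumes "a \<in> carrier G" "b \<in> carrier G"
  shows "ord (conj_op G a b) = ord a"
proof -
  have pow: "conj_op G a b [^] n = conj_op G (a [^] n) b" for n :: nat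
  proof (induction n)
    case 0
    then show ?case using assms by (simp add: conj_op_def)
  next
    case (Suc n)
    have "b \<otimes> (inv b \<otimes> (a \<otimes> b)) = a \<otimes> b"
      using assms by (simp flip: m_assoc)
    then have "conj_op G (a [^] n) b \<otimes> conj_op G a b = conj_op G (a [^] Suc n) b"
      using assms by (simp add: conj_op_def m_assoc)
    then show ?case using Suc by simp
  qed
  have "conj_op G c b = \<one> \<longleftrightarrow> c = \<one>" if "c \<in> carrier G" for c
  proof
    assume "conj_op G c b = \<one>"
    then have "b \<otimes> conj_op G c b \<otimes> inv b = \<one>" using assms by simp
    moreover have "b \<otimes> (inv b \<otimes> c) = c"
      using assms that by (simp flip: m_assoc)
    then have "b \<otimes> conj_op G c b \<otimes> inv b = c"
      using assms that by (simp add: conj_op_def m_assoc)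
    ultimately show "c = \<one>" using assms that by simp
  qed (use assms in \<open>simp add: conj_op_def\<close>)
  then have "conj_op G a b [^] n = \<one> \<longleftrightarrow> a [^] n = \<one>" for n :: nat
    using assms by (simp add: pow)
  then show ?thesis
    using assms pow_eq_id conj_op_closed by (metis dvd_antisym dvd_refl)
qed

lemma gen_classes_disjoint_union:
  "gen_classes G \<Gamma> = fin_gen_classes G \<Gamma> \<union> inf_gen_classes G \<Gamma>"
  "fin_gen_classes G \<Gamma> \<inter> inf_gen_classes G \<Gamma> = {}"
  by (auto simp: fin_gen_classes_def inf_gen_classes_def gen_classes_def conj_classes_def
      conj_class_def ord_conj_op)

lemma dehn_proj_respects:
  assumes "\<Gamma> \<subseteq> carrier G" "(u, v) \<in> dehn_rels G \<Gamma>"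
  shows "word_eval G (\<lambda>a. a) u = word_eval G (\<lambda>a. a) v"
proof -
  obtain a b where ab: "a \<in> carrier G" "b \<in> carrier G"
    "u = [(a, True), (b, True)]" "v = [(b, True), (conj_op G a b, True)]"
    using assms dehn_quandle_carrier[OF assms(1)] by (auto simp: dehn_rels_def)
  then have "b \<otimes> conj_op G a b = a \<otimes> b"
    by (simp add: conj_op_def m_assoc flip: m_assoc[of b "inv b"])
  then show ?thesis using ab by (simp add: word_eval_def conj_op_closed)
qed

lemma
  assumes "\<Gamma> \<subseteq> carrier G"
  shows dehn_proj_hom: "dehn_proj G \<in> hom (dehn_group G \<Gamma>) G"
    and dehn_proj_gen: "a \<in> dehn_quandle G \<Gamma> \<Longrightarrow> dehn_proj G (dehn_gen G \<Gamma> a) = a"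
proof -
  have f: "(\<lambda>a. a) \<in> dehn_quandle G \<Gamma> \<rightarrow> carrier G"
    using dehn_quandle_carrier[OF assms] by auto
  note r = dehn_proj_respects[OF assms]
  show "dehn_proj G \<in> hom (dehn_group G \<Gamma>) G"
    unfolding dehn_proj_def dehn_group_def by (rule presented_lift_hom[OF f r])
  show "dehn_proj G (dehn_gen G \<Gamma> a) = a" if "a \<in> dehn_quandle G \<Gamma>"
  proof -
    have "dehn_proj G (dehn_gen G \<Gamma> a) = word_eval G (\<lambda>a. a) [(a, True)]"
      unfolding dehn_proj_def dehn_gen_def
      by (rule presented_lift_word_class[OF f r]) (use that in auto)
    then show ?thesis using that dehn_quandle_carrier[OF assms] by (auto simp: word_eval_def)
  qed
qed

lemma dehn_ab_respects:
  assumes "\<Gamma> \<subseteq> carrier G" "(u, v) \<in> dehn_rels G \<Gamma>"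
  shows "word_eval (free_Abelian_group (gen_classes G \<Gamma>)) (\<lambda>a. frag_of (conj_class G a)) u
       = word_eval (free_Abelian_group (gen_classes G \<Gamma>)) (\<lambda>a. frag_of (conj_class G a)) v"
  using assms dehn_quandle_carrier[OF assms(1)]
  by (auto simp: dehn_rels_def word_eval_def conj_class_conj_op subset_iff)

lemma
  assumes "\<Gamma> \<subseteq> carrier G"
  shows dehn_ab_hom: "dehn_ab G \<Gamma> \<in> hom (dehn_group G \<Gamma>) (free_Abelian_group (gen_classes G \<Gamma>))"
    and dehn_ab_gen:
      "a \<in> dehn_quandle G \<Gamma> \<Longrightarrow> dehn_ab G \<Gamma> (dehn_gen G \<Gamma> a) = frag_of (conj_class G a)"
proof -
  interpret Z: group "free_Abelian_group (gen_classes G \<Gamma>)" by simp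
  have f: "(\<lambda>a. frag_of (conj_class G a)) \<in>
      dehn_quandle G \<Gamma> \<rightarrow> carrier (free_Abelian_group (gen_classes G \<Gamma>))"
    using conj_class_gen_classes[OF assms] by auto
  note r = dehn_ab_respects[OF assms]
  show "dehn_ab G \<Gamma> \<in> hom (dehn_group G \<Gamma>) (free_Abelian_group (gen_classes G \<Gamma>))"
    unfolding dehn_ab_def dehn_group_def by (rule Z.presented_lift_hom[OF f r])
  show "dehn_ab G \<Gamma> (dehn_gen G \<Gamma> a) = frag_of (conj_class G a)" if "a \<in> dehn_quandle G \<Gamma>"
  proof -
    have "dehn_ab G \<Gamma> (dehn_gen G \<Gamma> a) =
        word_eval (free_Abelian_group (gen_classes G \<Gamma>)) (\<lambda>a. frag_of (conj_class G a)) [(a, True)]"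
      unfolding dehn_ab_def dehn_gen_def
      by (rule Z.presented_lift_word_class[OF f r]) (use that in auto)
    then show ?thesis by (simp add: word_eval_def)
  qed
qed

lemma fin_proj_hom:
  "fin_proj G \<Gamma> \<in> hom (free_Abelian_group (gen_classes G \<Gamma>)) (free_Abelian_group (fin_gen_classes G \<Gamma>))"
proof (rule homI)
  fix x
  have "Poly_Mapping.keys (fin_proj G \<Gamma> x) \<subseteq> (\<Union>\<O>\<in>Poly_Mapping.keys x.
      Poly_Mapping.keys (if \<O> \<in> fin_gen_classes G \<Gamma> then frag_of \<O> else 0))"
    unfolding fin_proj_def by (rule keys_frag_extend)
  also have "\<dots> \<subseteq> fin_gen_classes G \<Gamma>"
    by (rule UN_least) simp
  finally show "fin_proj G \<Gamma> x \<in> carrier (free_Abelian_group (fin_gen_classes G \<Gamma>))"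
    by simp
qed (simp add: fin_proj_def frag_extend_add)

lemma dehn_ab_fin_hom:
  assumes "\<Gamma> \<subseteq> carrier G"
  shows "dehn_ab_fin G \<Gamma> \<in> hom (dehn_group G \<Gamma>) (free_Abelian_group (fin_gen_classes G \<Gamma>))"
  unfolding dehn_ab_fin_def by (rule Group.hom_compose[OF dehn_ab_hom[OF assms] fin_proj_hom])

end

end

theory Submission
  imports Defs
begin

text \<open>
  In \<open>D = G\<^sup>D\<close> one has \<open>e\<^sub>a z = z e\<^sub>b\<close> with \<open>b = \<pi>(z)\<^sup>-\<^sup>1 a \<pi>(z)\<close>. Hence the kernel of \<open>\<pi>\<close> is central, and
  \<open>D\<close> is generated by the elements \<open>e\<^sub>x\<close> with \<open>x \<in> \<Gamma>\<close>. These satisfy the conjugation relations of \<open>\<Pi>\<close>,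
  and they satisfy the power relations \<open>x\<^sup>k = 1\<close> modulo the central subgroup \<open>T\<close> generated by the
  corresponding \<open>e\<^sub>x\<^sup>k\<close>, so the kernel of \<open>\<pi>\<close> is contained in \<open>T\<close>. As there is at most one power relation
  for each class, \<open>T\<close> is an image of the free abelian group on the classes carrying a power relation,
  and \<open>Ab\<^sub>f\<close> sends \<open>e\<^sub>x\<^sup>k\<close> to \<open>k c\<^sub>\<O>\<close> with \<open>x \<in> \<O>\<close>. Therefore \<open>Ab\<^sub>f\<close> is injective on \<open>T\<close>.
\<close>

section \<open>Presented groups and evaluation of words\<close>

lemma presented_group_induct [consumes 1, case_names one gen inv_gen]:
  assumes "z \<in> carrier (presented_group X R)"
    and "P \<one>\<^bsub>presented_group X R\<^esub>"
    and "\<And>x z. x \<in> X \<Longrightarrow> z \<in> carrier (presented_group X R) \<Longrightarrow> P z \<Longrightarrow>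
           P (word_class X R [(x, True)] \<otimes>\<^bsub>presented_group X R\<^esub> z)"
    and "\<And>x z. x \<in> X \<Longrightarrow> z \<in> carrier (presented_group X R) \<Longrightarrow> P z \<Longrightarrow>
           P (inv\<^bsub>presented_group X R\<^esub> word_class X R [(x, True)] \<otimes>\<^bsub>presented_group X R\<^esub> z)"
  shows "P z"
proof -
  interpret D: group "presented_group X R" by (rule presented_group_group)
  \<comment> \<open>A negative letter represents the inverse of its generator, so prefixing a letter
    to a word is one of the two induction steps.\<close>
  have inv: "inv\<^bsub>presented_group X R\<^esub> word_class X R [(x, True)] = word_class X R [(x, False)]"
    if "x \<in> X" for x
  proof (rule D.inv_equality)
    show "word_class X R [(x, False)] \<otimes>\<^bsub>presented_group X R\<^esub> word_class X R [(x, True)]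
        = \<one>\<^bsub>presented_group X R\<^esub>"
      using that word_cong.cancel[OF that, of R False]
      by (simp add: presented_mult presented_one word_class_eq_iff)
  qed (use that in \<open>auto simp: presented_carrier\<close>)
  have "P (word_class X R w)" if "w \<in> words X" for w
    using that
  proof (induction w)
    case Nil
    then show ?case using assms(2) by (simp add: presented_one)
  next
    case (Cons p w)
    obtain x b where p: "p = (x, b)" by (cases p)
    have w: "x \<in> X" "w \<in> words X" using Cons.prems p by auto
    then have "word_class X R (p # w)
        = word_class X R [(x, b)] \<otimes>\<^bsub>presented_group X R\<^esub> word_class X R w"
      by (simp add: p presented_mult)
    then show ?case
      using assms(3,4)[OF w(1) _ Cons.IH[OF w(2)]] w inv[OF w(1)]
      by (cases b) (auto simp: presented_carrier)
  qed
  then show ?thesis using assms(1) by (auto simp: presented_carrier)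
qed

lemma (in group_hom) hom_word_eval:
  assumes "f \<in> X \<rightarrow> carrier G" "w \<in> words X"
  shows "h (word_eval G f w) = word_eval H (h \<circ> f) w"
  using assms(2)
proof (induction w)
  case (Cons p w)
  obtain x b where p: "p = (x, b)" by (cases p)
  have "x \<in> X" "w \<in> words X" using Cons.prems p by auto
  moreover have "f x \<in> carrier G" "word_eval G f w \<in> carrier G"
    using calculation assms(1) G.word_eval_closed[OF assms(1)] by auto
  ultimately show ?case using Cons.IH p by (auto simp: word_eval_def)
qed (simp add: word_eval_def)

context group
begin

text \<open>Moving \<open>x\<close> past a product changes it once per factor. Both inductions over
  the Dehn group rest on this: with successive conjugates for \<open>dehn_gen_mult\<close>, and with
  \<open>x\<close>, \<open>x'\<close>, \<open>x''\<close> all equal for centrality of the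
  kernel.\<close>

lemma mult_mult_commute:
  assumes "x \<otimes> y = y \<otimes> x'" "x' \<otimes> z = z \<otimes> x''"
    and "x \<in> carrier G" "x' \<in> carrier G" "x'' \<in> carrier G" "y \<in> carrier G" "z \<in> carrier G"
  shows "x \<otimes> (y \<otimes> z) = (y \<otimes> z) \<otimes> x''"
proof -
  have "x \<otimes> (y \<otimes> z) = (y \<otimes> x') \<otimes> z" using assms(3-) by (simp flip: assms(1) m_assoc)
  also have "\<dots> = y \<otimes> (z \<otimes> x'')" using assms(3-) by (simp add: m_assoc assms(2))
  finally show ?thesis using assms(3-) by (simp add: m_assoc)
qed

text \<open>Handles an inverse generator in the same inductions: passing \<open>inv y\<close> undoes
  the change made by passing \<open>y\<close>, so \<open>x\<close> and \<open>x'\<close> swap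
  roles.\<close>

lemma mult_inv_commute:
  assumes "x' \<otimes> y = y \<otimes> x"
    and "x \<in> carrier G" "x' \<in> carrier G" "y \<in> carrier G"
  shows "x \<otimes> inv y = inv y \<otimes> x'"
proof -
  have "x = inv y \<otimes> (x' \<otimes> y)" using assms(2-) unfolding assms(1) by (simp flip: m_assoc)
  also have "\<dots> = inv y \<otimes> x' \<otimes> y" using assms(2-) by (simp add: m_assoc)
  finally have "x \<otimes> inv y = inv y \<otimes> x' \<otimes> y \<otimes> inv y" by simp
  then show ?thesis using assms(2-) by (simp add: m_assoc)
qed

lemma word_eval_word_inv:
  assumes "f \<in> X \<rightarrow> carrier G" "w \<in> words X"
  shows "word_eval G f (word_inv w) = inv (word_eval G f w)"
proof (rule inv_equality[symmetric])
  \<comment> \<open>With the empty set of relations there is nothing for \<open>f\<close> to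
    respect; free cancellation alone trivialises the word.\<close>
  have "word_eval G f (word_inv w @ w) = word_eval G f []"
    by (rule word_eval_cong[OF word_inv_left[of w X "{}"]]) (use assms in auto)
  then show "word_eval G f (word_inv w) \<otimes> word_eval G f w = \<one>"
    using assms by (simp add: word_eval_append word_inv_words) (simp add: word_eval_def)
qed (use assms in \<open>auto intro: word_eval_closed word_inv_words\<close>)

lemma word_eval_replicate:
  "f x \<in> carrier G \<Longrightarrow> word_eval G f (replicate k (x, True)) = f x [^] k"
proof (induction k)
  case (Suc k)
  have "word_eval G f (replicate (Suc k) (x, True)) = f x \<otimes> word_eval G f (replicate k (x, True))"
    by (simp add: word_eval_def)
  then show ?case using Suc by (simp only: nat_pow_Suc2)
qed (simp add: word_eval_def)

lemma word_eval_conj_rel: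
  assumes "f a \<in> carrier G" "f b \<in> carrier G" "f c \<in> carrier G" "conj_rel a b c = (u, v)"
  shows "word_eval G f u = conj_op G (f a) (f b)" "word_eval G f v = f c"
  using assms by (auto simp: conj_rel_def word_eval_def conj_op_def m_assoc)

lemma presentation_surj:
  assumes "is_presentation G X \<gamma> R"
  shows "word_eval G \<gamma> ` words X = carrier G"
proof -
  have \<gamma>: "\<gamma> \<in> X \<rightarrow> carrier G"
    and rel: "\<And>u v. (u, v) \<in> R \<Longrightarrow> word_eval G \<gamma> u = word_eval G \<gamma> v"
    and iso: "presented_lift G \<gamma> \<in> iso (presented_group X R) G"
    using assms by (auto simp: is_presentation_def)
  have "carrier G = presented_lift G \<gamma> ` word_class X R ` words X"
    using iso by (simp add: iso_def bij_betw_def presented_carrier)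
  also have "\<dots> = word_eval G \<gamma> ` words X"
    unfolding image_image by (rule image_cong[OF HOL.refl presented_lift_word_class[OF \<gamma> rel]])
  finally show ?thesis ..
qed

text \<open>Injectivity of the presentation isomorphism, in the form in which it is used: an
  equality in \<open>G\<close> yields a derivation from \<open>R\<close>, which can be replayed in
  any group where \<open>R\<close> holds.\<close>

lemma presentation_word_cong:
  assumes "is_presentation G X \<gamma> R" "u \<in> words X" "v \<in> words X"
    and "word_eval G \<gamma> u = word_eval G \<gamma> v"
  shows "word_cong X R u v"
proof -
  have \<gamma>: "\<gamma> \<in> X \<rightarrow> carrier G"
    and rel: "\<And>u v. (u, v) \<in> R \<Longrightarrow> word_eval G \<gamma> u = word_eval G \<gamma> v"
    and inj: "inj_on (presented_lift G \<gamma>) (carrier (presented_group X R))"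
    using assms(1) by (auto simp: is_presentation_def iso_def bij_betw_def)
  have "word_class X R u = word_class X R v"
    by (rule inj_onD[OF inj])
       (use assms presented_lift_word_class[OF \<gamma> rel] in \<open>auto simp: presented_carrier\<close>)
  then show ?thesis using assms by (simp add: word_class_eq_iff)
qed

section \<open>Conjugation in the Dehn group and centrality of the kernel\<close>

lemma group_dehn_group: "group (dehn_group G \<Gamma>)"
  by (simp add: dehn_group_def presented_group_group)

lemma dehn_gen_closed:
  "a \<in> dehn_quandle G \<Gamma> \<Longrightarrow> dehn_gen G \<Gamma> a \<in> carrier (dehn_group G \<Gamma>)"
  by (simp add: dehn_gen_def dehn_group_def presented_carrier)

lemma subset_dehn_quandle: "\<Gamma> \<subseteq> carrier G \<Longrightarrow> \<Gamma> \<subseteq> dehn_quandle G \<Gamma>"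
  unfolding dehn_quandle_def using conj_class_self by blast

lemma dehn_group_induct [consumes 1, case_names one gen inv_gen]:
  assumes "z \<in> carrier (dehn_group G \<Gamma>)"
    and "P \<one>\<^bsub>dehn_group G \<Gamma>\<^esub>"
    and "\<And>a z. a \<in> dehn_quandle G \<Gamma> \<Longrightarrow> z \<in> carrier (dehn_group G \<Gamma>) \<Longrightarrow> P z \<Longrightarrow>
           P (dehn_gen G \<Gamma> a \<otimes>\<^bsub>dehn_group G \<Gamma>\<^esub> z)"
    and "\<And>a z. a \<in> dehn_quandle G \<Gamma> \<Longrightarrow> z \<in> carrier (dehn_group G \<Gamma>) \<Longrightarrow> P z \<Longrightarrow>
           P (inv\<^bsub>dehn_group G \<Gamma>\<^esub> dehn_gen G \<Gamma> a \<otimes>\<^bsub>dehn_group G \<Gamma>\<^esub> z)"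
  shows "P z"
  using assms unfolding dehn_group_def dehn_gen_def by (rule presented_group_induct)

lemma dehn_gen_mult_gen:
  assumes "\<Gamma> \<subseteq> carrier G" "a \<in> dehn_quandle G \<Gamma>" "b \<in> dehn_quandle G \<Gamma>"
  shows "dehn_gen G \<Gamma> a \<otimes>\<^bsub>dehn_group G \<Gamma>\<^esub> dehn_gen G \<Gamma> b
       = dehn_gen G \<Gamma> b \<otimes>\<^bsub>dehn_group G \<Gamma>\<^esub> dehn_gen G \<Gamma> (conj_op G a b)"
proof -
  have c: "conj_op G a b \<in> dehn_quandle G \<Gamma>"
    using assms dehn_quandle_carrier dehn_quandle_conj_op by blast
  have "word_cong (dehn_quandle G \<Gamma>) (dehn_rels G \<Gamma>)
      [(a, True), (b, True)] [(b, True), (conj_op G a b, True)]"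
    by (rule word_cong.rel) (use assms c in \<open>auto simp: dehn_rels_def\<close>)
  then show ?thesis
    using assms c by (simp add: dehn_group_def dehn_gen_def presented_mult word_class_eq_iff)
qed

text \<open>For a generator \<open>z\<close> this is a defining relation, and it propagates along
  products and inverses. The element \<open>a\<close> has to vary in the induction, since passing
  one factor replaces it by a conjugate.\<close>

lemma dehn_gen_mult:
  assumes "\<Gamma> \<subseteq> carrier G" "z \<in> carrier (dehn_group G \<Gamma>)" "a \<in> dehn_quandle G \<Gamma>"
  shows "dehn_gen G \<Gamma> a \<otimes>\<^bsub>dehn_group G \<Gamma>\<^esub> z
       = z \<otimes>\<^bsub>dehn_group G \<Gamma>\<^esub> dehn_gen G \<Gamma> (conj_op G a (dehn_proj G z))"
  using assms(2,3)
proof (induction z arbitrary: a rule: dehn_group_induct)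
  note Q = dehn_quandle_carrier[OF assms(1)]
  interpret D: group "dehn_group G \<Gamma>" by (rule group_dehn_group)
  interpret \<pi>: group_hom "dehn_group G \<Gamma>" G "dehn_proj G"
    by unfold_locales (rule dehn_proj_hom[OF assms(1)])
  {
    case one
    then show ?case using Q by (auto simp: conj_op_def dehn_gen_closed)
  next
    case (gen b z)
    have carr: "a \<in> carrier G" "b \<in> carrier G" using gen Q by auto
    have c: "conj_op G a b \<in> dehn_quandle G \<Gamma>"
      using dehn_quandle_conj_op[OF assms(1) gen(4) carr(2)] .
    have d: "conj_op G (conj_op G a b) (dehn_proj G z) \<in> dehn_quandle G \<Gamma>"
      using dehn_quandle_conj_op[OF assms(1) c] gen(2) by simp
    have "conj_op G (conj_op G a b) (dehn_proj G z)
        = conj_op G a (dehn_proj G (dehn_gen G \<Gamma> b \<otimes>\<^bsub>dehn_group G \<Gamma>\<^esub> z))"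
      using gen(1,2) carr by (simp add: conj_op_conj_op dehn_gen_closed dehn_proj_gen[OF assms(1)])
    then show ?case
      using D.mult_mult_commute[OF dehn_gen_mult_gen[OF assms(1) gen(4,1)] gen(3)[OF c]] gen(1,2,4) c d
      by (simp add: dehn_gen_closed)
  next
    case (inv_gen b z)
    \<comment> \<open>\<open>c\<close> is the element that \<open>b\<close> conjugates to
      \<open>a\<close>. The Dehn relation for \<open>c\<close> and \<open>b\<close> thus has the
      generator of \<open>a\<close> on its right-hand side and can be solved for the passage of that
      generator through the inverse.\<close>
    define c where "c = conj_op G a (inv b)"
    have carr: "a \<in> carrier G" "b \<in> carrier G" using inv_gen Q by auto
    have c: "c \<in> dehn_quandle G \<Gamma>"
      unfolding c_def using dehn_quandle_conj_op[OF assms(1) inv_gen(4)] carr by simp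
    have d: "conj_op G c (dehn_proj G z) \<in> dehn_quandle G \<Gamma>"
      using dehn_quandle_conj_op[OF assms(1) c] inv_gen(2) by simp
    have "conj_op G c b = a"
      using carr by (simp add: c_def conj_op_conj_op) (simp add: conj_op_def)
    then have "dehn_gen G \<Gamma> c \<otimes>\<^bsub>dehn_group G \<Gamma>\<^esub> dehn_gen G \<Gamma> b
        = dehn_gen G \<Gamma> b \<otimes>\<^bsub>dehn_group G \<Gamma>\<^esub> dehn_gen G \<Gamma> a"
      using dehn_gen_mult_gen[OF assms(1) c inv_gen(1)] by simp
    then have b: "dehn_gen G \<Gamma> a \<otimes>\<^bsub>dehn_group G \<Gamma>\<^esub> inv\<^bsub>dehn_group G \<Gamma>\<^esub> dehn_gen G \<Gamma> b
        = inv\<^bsub>dehn_group G \<Gamma>\<^esub> dehn_gen G \<Gamma> b \<otimes>\<^bsub>dehn_group G \<Gamma>\<^esub> dehn_gen G \<Gamma> c"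
      by (rule D.mult_inv_commute) (use inv_gen(1,4) c in \<open>auto simp: dehn_gen_closed\<close>)
    have "conj_op G c (dehn_proj G z)
        = conj_op G a (dehn_proj G (inv\<^bsub>dehn_group G \<Gamma>\<^esub> dehn_gen G \<Gamma> b \<otimes>\<^bsub>dehn_group G \<Gamma>\<^esub> z))"
      using inv_gen(1,2) carr
      by (simp add: c_def conj_op_conj_op dehn_gen_closed dehn_proj_gen[OF assms(1)])
    then show ?case
      using D.mult_mult_commute[OF b inv_gen(3)[OF c]] inv_gen(1,2,4) c d
      by (simp add: dehn_gen_closed)
  }
qed

text \<open>When \<open>dehn_proj G z\<close> is trivial, the conjugation in
  \<open>dehn_gen_mult\<close> disappears, so \<open>z\<close> commutes with every generator and
  hence with all products of generators and their inverses.\<close>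

lemma dehn_proj_kernel_central:
  assumes "\<Gamma> \<subseteq> carrier G" "z \<in> kernel (dehn_group G \<Gamma>) G (dehn_proj G)"
    and "y \<in> carrier (dehn_group G \<Gamma>)"
  shows "y \<otimes>\<^bsub>dehn_group G \<Gamma>\<^esub> z = z \<otimes>\<^bsub>dehn_group G \<Gamma>\<^esub> y"
  using assms(3)
proof (induction y rule: dehn_group_induct)
  interpret D: group "dehn_group G \<Gamma>" by (rule group_dehn_group)
  have z: "z \<in> carrier (dehn_group G \<Gamma>)" "dehn_proj G z = \<one>"
    using assms(2) by (auto simp: kernel_def)
  have comm: "dehn_gen G \<Gamma> a \<otimes>\<^bsub>dehn_group G \<Gamma>\<^esub> z = z \<otimes>\<^bsub>dehn_group G \<Gamma>\<^esub> dehn_gen G \<Gamma> a"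
    if "a \<in> dehn_quandle G \<Gamma>" for a
    using dehn_gen_mult[OF assms(1) z(1) that] z that dehn_quandle_carrier[OF assms(1)]
    by (auto simp: conj_op_def)
  {
    case one
    then show ?case using z by simp
  next
    case (gen a y)
    show ?case
      using D.mult_mult_commute[OF comm[OF gen(1), symmetric] gen(3)[symmetric]] gen(1,2) z
      by (simp add: dehn_gen_closed)
  next
    case (inv_gen a y)
    have "z \<otimes>\<^bsub>dehn_group G \<Gamma>\<^esub> inv\<^bsub>dehn_group G \<Gamma>\<^esub> dehn_gen G \<Gamma> a
        = inv\<^bsub>dehn_group G \<Gamma>\<^esub> dehn_gen G \<Gamma> a \<otimes>\<^bsub>dehn_group G \<Gamma>\<^esub> z"
      by (rule D.mult_inv_commute) (use inv_gen(1) comm z in \<open>auto simp: dehn_gen_closed\<close>)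
    then show ?case
      using D.mult_mult_commute[OF _ inv_gen(3)[symmetric]] inv_gen(1,2) z
      by (simp add: dehn_gen_closed)
  }
qed

text \<open>A conjugate \<open>a = g\<^sup>-\<^sup>1 x g\<close> of a generator \<open>x\<close> needs no generator of its own: writing \<open>g\<close> as a word in
  \<open>\<Gamma>\<close> and lifting this word to \<open>y \<in> D\<close> gives \<open>e\<^sub>a = y\<^sup>-\<^sup>1 e\<^sub>x y\<close>.\<close>

lemma dehn_group_generated:
  assumes \<gamma>: "\<gamma> \<in> X \<rightarrow> carrier G" and surj: "word_eval G \<gamma> ` words X = carrier G"
    and z: "z \<in> carrier (dehn_group G (\<gamma> ` X))"
  shows "\<exists>w\<in>words X. z = word_eval (dehn_group G (\<gamma> ` X)) (dehn_gen G (\<gamma> ` X) \<circ> \<gamma>) w"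
proof -
  define D where "D = dehn_group G (\<gamma> ` X)"
  define e where "e = dehn_gen G (\<gamma> ` X)"
  have \<Gamma>: "\<gamma> ` X \<subseteq> carrier G" using \<gamma> by auto
  interpret D: group D unfolding D_def by (rule group_dehn_group)
  interpret \<pi>: group_hom D G "dehn_proj G"
    by unfold_locales (use dehn_proj_hom[OF \<Gamma>] in \<open>simp add: D_def\<close>)
  have e: "e \<circ> \<gamma> \<in> X \<rightarrow> carrier D"
    using subset_dehn_quandle[OF \<Gamma>] dehn_gen_closed by (auto simp: D_def e_def)
  have lift: "\<exists>w\<in>words X. e a = word_eval D (e \<circ> \<gamma>) w" if a: "a \<in> dehn_quandle G (\<gamma> ` X)" for a
  proof -
    obtain x g where x: "x \<in> X" "g \<in> carrier G" "a = conj_op G (\<gamma> x) g"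
      using a by (auto simp: dehn_quandle_def conj_class_def)
    obtain v where v: "v \<in> words X" "g = word_eval G \<gamma> v" using x surj by auto
    define y where "y = word_eval D (e \<circ> \<gamma>) v"
    have y: "y \<in> carrier D" unfolding y_def by (rule D.word_eval_closed[OF e v(1)])
    have ex: "e (\<gamma> x) \<in> carrier D" using e x by auto
    have ea: "e a \<in> carrier D" using a by (simp add: D_def e_def dehn_gen_closed)
    \<comment> \<open>\<open>y\<close> lifts \<open>g\<close>: projecting the value of
      \<open>v\<close> in \<open>D\<close> gives its value in \<open>G\<close>, since
      \<open>dehn_proj G\<close> sends each \<open>e (\<gamma> x)\<close> with \<open>x\<close> in
      \<open>X\<close> back to \<open>\<gamma> x\<close>.\<close>
    have "dehn_proj G y = word_eval G (dehn_proj G \<circ> (e \<circ> \<gamma>)) v"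
      unfolding y_def by (rule \<pi>.hom_word_eval[OF e v(1)])
    also have "\<dots> = word_eval G \<gamma> v"
      unfolding word_eval_def
      by (rule foldr_cong)
         (use v subset_dehn_quandle[OF \<Gamma>] in \<open>auto simp: words_def e_def dehn_proj_gen[OF \<Gamma>] subset_iff\<close>)
    finally have "dehn_proj G y = g" using v by simp
    then have "e (\<gamma> x) \<otimes>\<^bsub>D\<^esub> y = y \<otimes>\<^bsub>D\<^esub> e a"
      using dehn_gen_mult[OF \<Gamma>, of y "\<gamma> x"] y x subset_dehn_quandle[OF \<Gamma>]
      by (auto simp: D_def e_def)
    then have "e a = inv\<^bsub>D\<^esub> y \<otimes>\<^bsub>D\<^esub> (e (\<gamma> x) \<otimes>\<^bsub>D\<^esub> y)"
      using D.inv_solve_left[of "e a" y "e (\<gamma> x) \<otimes>\<^bsub>D\<^esub> y"] y ex ea by simp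
    \<comment> \<open>Keeping \<open>append_Cons\<close> out of the simplifier leaves the word in
      three pieces for \<open>word_eval_append\<close>.\<close>
    also have "\<dots> = word_eval D (e \<circ> \<gamma>) (word_inv v @ [(x, True)] @ v)"
      using v x ex y
      by (simp add: D.word_eval_append[OF e] D.word_eval_word_inv[OF e] word_inv_words
            del: append_Cons) (simp add: word_eval_def y_def)
    finally show ?thesis
      using v x word_inv_words by (intro bexI[of _ "word_inv v @ [(x, True)] @ v"]) auto
  qed
  have "\<exists>w\<in>words X. z = word_eval D (e \<circ> \<gamma>) w"
    using z
  proof (induction z rule: dehn_group_induct)
    case one
    show ?case by (rule bexI[of _ "[]"]) (auto simp: word_eval_def D_def)
  next
    case (gen a z)
    then obtain u v where uv: "u \<in> words X" "v \<in> words X"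
      and eq: "e a = word_eval D (e \<circ> \<gamma>) u" "z = word_eval D (e \<circ> \<gamma>) v"
      using lift by metis
    have "e a \<otimes>\<^bsub>D\<^esub> z = word_eval D (e \<circ> \<gamma>) (u @ v)"
      unfolding eq D.word_eval_append[OF e uv] ..
    then show ?case
      unfolding D_def[symmetric] e_def[symmetric] by (rule bexI) (simp add: uv)
  next
    case (inv_gen a z)
    then obtain u v where uv: "u \<in> words X" "v \<in> words X"
      and eq: "e a = word_eval D (e \<circ> \<gamma>) u" "z = word_eval D (e \<circ> \<gamma>) v"
      using lift by metis
    have "inv\<^bsub>D\<^esub> e a \<otimes>\<^bsub>D\<^esub> z = word_eval D (e \<circ> \<gamma>) (word_inv u @ v)"
      unfolding eq D.word_eval_append[OF e word_inv_words[OF uv(1)] uv(2)]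
        D.word_eval_word_inv[OF e uv(1)] ..
    then show ?case
      unfolding D_def[symmetric] e_def[symmetric] by (rule bexI) (simp add: uv word_inv_words)
  qed
  then show ?thesis by (simp add: D_def e_def)
qed

text \<open>The equation forces \<open>a\<close> to have finite order, so \<open>fin_proj\<close>
  keeps its class; on a class of infinite order the value would be 0.\<close>

lemma dehn_ab_fin_gen_pow:
  assumes "\<Gamma> \<subseteq> carrier G" "a \<in> \<Gamma>" "a [^] k = \<one>" "k \<noteq> (0::nat)"
  shows "dehn_ab_fin G \<Gamma> (dehn_gen G \<Gamma> a [^]\<^bsub>dehn_group G \<Gamma>\<^esub> k) = frag_cmul (int k) (frag_of (conj_class G a))"
proof -
  have a: "a \<in> carrier G" "a \<in> dehn_quandle G \<Gamma>"
    using assms subset_dehn_quandle by auto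
  have "ord a \<noteq> 0" using assms a pow_eq_id[of a k] by auto
  then have fin: "conj_class G a \<in> fin_gen_classes G \<Gamma>"
    using conj_class_gen_classes[OF assms(1) a(2)] a
    by (auto simp: fin_gen_classes_def conj_class_def ord_conj_op)
  interpret D: group "dehn_group G \<Gamma>" by (rule group_dehn_group)
  interpret Ab: group_hom "dehn_group G \<Gamma>" "free_Abelian_group (fin_gen_classes G \<Gamma>)" "dehn_ab_fin G \<Gamma>"
    by (intro group_hom.intro group_hom_axioms.intro D.is_group dehn_ab_fin_hom assms(1)) simp
  have "dehn_ab_fin G \<Gamma> (dehn_gen G \<Gamma> a) = frag_of (conj_class G a)"
    using fin by (simp add: dehn_ab_fin_def dehn_ab_gen[OF assms(1) a(2)] fin_proj_def)
  then show ?thesis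
    using fin a by (simp add: Ab.hom_nat_pow dehn_gen_closed)
qed

end

theorem theorem4p3:
  fixes G :: "('g, 'm) monoid_scheme"
    and X :: "'x set" and \<gamma> :: "'x \<Rightarrow> 'g" and R :: "('x word \<times> 'x word) set"
  assumes "group G" and "Cbar_presentation G X \<gamma> R"
  shows "(\<lambda>z. (dehn_proj G z, dehn_ab_fin G (\<gamma> ` X) z))
           \<in> hom (dehn_group G (\<gamma> ` X)) (G \<times>\<times> free_Abelian_group (fin_gen_classes G (\<gamma> ` X)))
         \<and> inj_on (\<lambda>z. (dehn_proj G z, dehn_ab_fin G (\<gamma> ` X) z)) (carrier (dehn_group G (\<gamma> ` X)))"
proof -

  \<comment> \<open>The two homomorphisms and the kernel of \<pi>\<close>
  interpret group G by fact
  define D where "D = dehn_group G (\<gamma> ` X)"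
  define e where "e = dehn_gen G (\<gamma> ` X)"
  define F where "F = free_Abelian_group (fin_gen_classes G (\<gamma> ` X))"
  define Ab where "Ab = dehn_ab_fin G (\<gamma> ` X)"
  define K where "K = kernel D G (dehn_proj G)"
  have pres: "is_presentation G X \<gamma> R"
    and rels: "\<And>r. r \<in> R \<Longrightarrow>
      (\<exists>a\<in>X. \<exists>b\<in>X. \<exists>c\<in>X. r = conj_rel a b c) \<or> (\<exists>a\<in>X. \<exists>k\<ge>2. r = power_rel a k)"
    and uniq: "\<And>\<O>. \<O> \<in> conj_classes G \<Longrightarrow>
      \<exists>\<^sub>\<le>\<^sub>1r. r \<in> R \<and> (\<exists>a\<in>X. \<exists>k\<ge>2. r = power_rel a k \<and> \<gamma> a \<in> \<O>)"
    using assms(2) by (auto simp: Cbar_presentation_def)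
  have \<gamma>: "\<gamma> \<in> X \<rightarrow> carrier G"
    and R_eval: "\<And>u v. (u, v) \<in> R \<Longrightarrow> word_eval G \<gamma> u = word_eval G \<gamma> v"
    using pres by (auto simp: is_presentation_def)
  have \<Gamma>: "\<gamma> ` X \<subseteq> carrier G" using \<gamma> by auto
  have \<gamma>Q: "\<gamma> x \<in> dehn_quandle G (\<gamma> ` X)" if "x \<in> X" for x
    using subset_dehn_quandle[OF \<Gamma>] that by auto
  have e_closed: "e (\<gamma> x) \<in> carrier D" if "x \<in> X" for x
    using \<gamma>Q[OF that] by (simp add: D_def e_def dehn_gen_closed)
  then have e: "e \<circ> \<gamma> \<in> X \<rightarrow> carrier D" by auto
  interpret D: group D unfolding D_def by (rule group_dehn_group)
  interpret F: group F unfolding F_def by simp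
  interpret \<pi>: group_hom D G "dehn_proj G"
    by unfold_locales (use dehn_proj_hom[OF \<Gamma>] in \<open>simp add: D_def\<close>)
  interpret Ab: group_hom D F Ab
    by unfold_locales (use dehn_ab_fin_hom[OF \<Gamma>] in \<open>simp add: D_def F_def Ab_def\<close>)
  have \<pi>_e: "dehn_proj G (e (\<gamma> x)) = \<gamma> x" if "x \<in> X" for x
    using dehn_proj_gen[OF \<Gamma> \<gamma>Q[OF that]] by (simp add: e_def)

  have K: "subgroup K D" unfolding K_def by (rule \<pi>.subgroup_kernel)
  have K_central: "y \<otimes>\<^bsub>D\<^esub> z = z \<otimes>\<^bsub>D\<^esub> y" if "z \<in> K" "y \<in> carrier D" for y z
    using dehn_proj_kernel_central[OF \<Gamma>] that by (simp add: K_def D_def)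
  \<comment> \<open>Centrality makes \<open>K\<close> an abelian group, as the universal property of
    free abelian groups requires of its target.\<close>
  have K_comm: "comm_group (D\<lparr>carrier := K\<rparr>)"
  proof (rule group.group_comm_groupI)
    show "group (D\<lparr>carrier := K\<rparr>)" by (rule D.subgroup_imp_group[OF K])
  qed (use K_central subgroup.mem_carrier[OF K] in auto)

  \<comment> \<open>Power relations and the classes that carry them\<close>
  define pow where "pow a k \<longleftrightarrow> a \<in> X \<and> 2 \<le> k \<and> power_rel a k \<in> R" for a k
  define S where "S = {conj_class G (\<gamma> a) | a k. pow a k}"
  \<comment> \<open>Uniqueness per class concerns relations, not values of \<open>\<gamma>\<close>.
    Equal power relations have equal words, nonempty as the exponent is at least 2, and so the same
    symbol and exponent, even if \<open>\<gamma>\<close> identifies several symbols.\<close>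
  have pow_uniq: "a = a' \<and> k = k'"
    if "pow a k" "pow a' k'" "conj_class G (\<gamma> a) = conj_class G (\<gamma> a')" for a k a' k'
  proof -
    have "conj_class G (\<gamma> a) \<in> conj_classes G"
      using that \<gamma> by (auto simp: conj_classes_def pow_def)
    moreover have "\<gamma> a \<in> conj_class G (\<gamma> a)" "\<gamma> a' \<in> conj_class G (\<gamma> a)"
      using that \<gamma> conj_class_self by (auto simp: pow_def)
    ultimately have "power_rel a k = power_rel a' k'"
      using that by (intro Uniq_D[OF uniq]) (auto simp: pow_def)
    then show ?thesis
      using that by (auto simp: power_rel_def pow_def replicate_eq_replicate)
  qed
  have "\<forall>\<O>\<in>S. \<exists>a k. pow a k \<and> conj_class G (\<gamma> a) = \<O>" by (auto simp: S_def)
  then obtain A N where AN: "\<And>\<O>. \<O> \<in> S \<Longrightarrow> pow (A \<O>) (N \<O>) \<and> conj_class G (\<gamma> (A \<O>)) = \<O>"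
    by metis
  have pow_one: "\<gamma> a [^]\<^bsub>G\<^esub> k = \<one>\<^bsub>G\<^esub>" if "pow a k" for a k
  proof -
    have "word_eval G \<gamma> (replicate k (a, True)) = word_eval G \<gamma> []"
      using that by (intro R_eval) (simp add: pow_def power_rel_def)
    moreover have "\<gamma> a \<in> carrier G" using that \<gamma> by (auto simp: pow_def)
    ultimately show ?thesis by (simp add: word_eval_replicate) (simp add: word_eval_def)
  qed
  have pow_K: "e (\<gamma> a) [^]\<^bsub>D\<^esub> k \<in> K" if "pow a k" for a k
  proof -
    have a: "a \<in> X" using that by (simp add: pow_def)
    show ?thesis
      using pow_one[OF that] e_closed[OF a] \<pi>_e[OF a] by (simp add: K_def kernel_def \<pi>.hom_nat_pow)
  qed

  \<comment> \<open>The central subgroup generated by the powers\<close>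
  obtain h where h: "h \<in> hom (free_Abelian_group S) (D\<lparr>carrier := K\<rparr>)"
    and h_of: "\<And>\<O>. \<O> \<in> S \<Longrightarrow> h (frag_of \<O>) = e (\<gamma> (A \<O>)) [^]\<^bsub>D\<^esub> N \<O>"
  proof (rule comm_group.free_Abelian_group_universal[OF K_comm])
    show "(\<lambda>\<O>. e (\<gamma> (A \<O>)) [^]\<^bsub>D\<^esub> N \<O>) ` S \<subseteq> carrier (D\<lparr>carrier := K\<rparr>)"
      using AN pow_K by auto
  qed (rule that)
  have h_hom: "group_hom (free_Abelian_group S) (D\<lparr>carrier := K\<rparr>) h"
    by (intro group_hom.intro group_hom_axioms.intro h D.subgroup_imp_group[OF K]) simp
  have h_K: "h x \<in> K" if "Poly_Mapping.keys x \<subseteq> S" for x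
    using hom_in_carrier[OF h, of x] that by simp
  have h_add: "h (x + y) = h x \<otimes>\<^bsub>D\<^esub> h y"
    if "Poly_Mapping.keys x \<subseteq> S" "Poly_Mapping.keys y \<subseteq> S" for x y
    using hom_mult[OF h, of x y] that by simp
  have h_zero: "h 0 = \<one>\<^bsub>D\<^esub>"
    using group_hom.hom_one[OF h_hom] by simp
  \<comment> \<open>As an image of the free abelian group on \<open>S\<close>, \<open>T\<close> has
    elements described by integer coordinates indexed by \<open>S\<close>.\<close>
  define T where "T = h ` carrier (free_Abelian_group S)"
  have T: "subgroup T D"
    using D.incl_subgroup[OF K group_hom.img_is_subgroup[OF h_hom]] by (simp add: T_def)
  have TK: "T \<subseteq> K" using h_K by (auto simp: T_def)
  have "T \<lhd> D"
  proof (rule D.normal_invI[OF T])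
    fix y z assume yz: "z \<in> T" "y \<in> carrier D"
    then have "y \<otimes>\<^bsub>D\<^esub> z \<otimes>\<^bsub>D\<^esub> inv\<^bsub>D\<^esub> y = z \<otimes>\<^bsub>D\<^esub> y \<otimes>\<^bsub>D\<^esub> inv\<^bsub>D\<^esub> y"
      using K_central[of z y] TK by auto
    then show "y \<otimes>\<^bsub>D\<^esub> z \<otimes>\<^bsub>D\<^esub> inv\<^bsub>D\<^esub> y \<in> T"
      using yz subgroup.mem_carrier[OF T] by (simp add: D.m_assoc)
  qed
  interpret T: normal T D by fact
  interpret q: group_hom D "D Mod T" "\<lambda>y. T #>\<^bsub>D\<^esub> y"
    by (intro group_hom.intro group_hom_axioms.intro T.factorgroup_is_group T.r_coset_hom_Mod) unfold_locales
  \<comment> \<open>By \<open>pow_uniq\<close> a given power relation is the one that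
    \<open>A\<close> and \<open>N\<close> select for its class, so the power is the image of a basis
    element.\<close>
  have pow_T: "e (\<gamma> a) [^]\<^bsub>D\<^esub> k \<in> T" if "pow a k" for a k
  proof -
    have S: "conj_class G (\<gamma> a) \<in> S" using that by (auto simp: S_def)
    have "A (conj_class G (\<gamma> a)) = a" "N (conj_class G (\<gamma> a)) = k"
      using AN[OF S] pow_uniq[OF _ that] by blast+
    then have "h (frag_of (conj_class G (\<gamma> a))) = e (\<gamma> a) [^]\<^bsub>D\<^esub> k"
      using h_of[OF S] by simp
    then show ?thesis using S unfolding T_def by (metis frag_of_in_free_Abelian_group imageI)
  qed

  \<comment> \<open>The kernel of \<pi> lies in \<open>T\<close>\<close>
  have rel_T: "word_eval (D Mod T) ((\<lambda>y. T #>\<^bsub>D\<^esub> y) \<circ> (e \<circ> \<gamma>)) u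
      = word_eval (D Mod T) ((\<lambda>y. T #>\<^bsub>D\<^esub> y) \<circ> (e \<circ> \<gamma>)) v" if uv: "(u, v) \<in> R" for u v
  proof -
    have w: "u \<in> words X" "v \<in> words X" using pres uv by (auto simp: is_presentation_def)
    have "T #>\<^bsub>D\<^esub> word_eval D (e \<circ> \<gamma>) u = T #>\<^bsub>D\<^esub> word_eval D (e \<circ> \<gamma>) v"
      using rels[OF uv]
    proof (elim disjE bexE exE conjE)
      fix a b c assume abc: "a \<in> X" "b \<in> X" "c \<in> X" "(u, v) = conj_rel a b c"
      \<comment> \<open>A conjugation relation holds already in \<open>D\<close>: read in
        \<open>G\<close>, it identifies \<open>\<gamma> c\<close> with the conjugate in the Dehn
        relation for \<open>\<gamma> a\<close> and \<open>\<gamma> b\<close>.\<close>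
      have c: "\<gamma> c = conj_op G (\<gamma> a) (\<gamma> b)"
        using word_eval_conj_rel[of \<gamma> a b c u v] abc \<gamma> R_eval[OF uv] by auto
      have "e (\<gamma> a) \<otimes>\<^bsub>D\<^esub> e (\<gamma> b) = e (\<gamma> b) \<otimes>\<^bsub>D\<^esub> e (\<gamma> c)"
        unfolding c using dehn_gen_mult_gen[OF \<Gamma> \<gamma>Q \<gamma>Q] abc by (simp add: D_def e_def)
      then have "conj_op D (e (\<gamma> a)) (e (\<gamma> b)) = e (\<gamma> c)"
        using abc e_closed D.inv_solve_left[of "e (\<gamma> c)" "e (\<gamma> b)" "e (\<gamma> a) \<otimes>\<^bsub>D\<^esub> e (\<gamma> b)"]
        by (simp add: conj_op_def D.m_assoc)
      then show ?thesis
        using D.word_eval_conj_rel[of "e \<circ> \<gamma>" a b c u v] abc e_closed by simp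
    next
      fix a k assume ak: "a \<in> X" "2 \<le> k" "(u, v) = power_rel a k"
      then have "e (\<gamma> a) [^]\<^bsub>D\<^esub> k \<in> T" using uv by (intro pow_T) (auto simp: pow_def)
      moreover have "word_eval D (e \<circ> \<gamma>) u = e (\<gamma> a) [^]\<^bsub>D\<^esub> k" "word_eval D (e \<circ> \<gamma>) v = \<one>\<^bsub>D\<^esub>"
        using ak D.word_eval_replicate[of "e \<circ> \<gamma>" a k] e_closed
        by (auto simp: power_rel_def word_eval_def[of _ _ "[]"])
      ultimately show ?thesis
        using T.rcos_const[OF D.is_group] T.one_closed by simp
    qed
    then show ?thesis unfolding q.hom_word_eval[OF e w(1)] q.hom_word_eval[OF e w(2)] .
  qed
  have K_T: "z \<in> T" if "z \<in> K" for z
  proof -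
    have z: "z \<in> carrier D" "dehn_proj G z = \<one>\<^bsub>G\<^esub>" using that by (auto simp: K_def kernel_def)
    obtain w where w: "w \<in> words X" "z = word_eval D (e \<circ> \<gamma>) w"
      using dehn_group_generated[OF \<gamma> presentation_surj[OF pres]] z by (auto simp: D_def e_def)
    have "word_eval G \<gamma> w = word_eval G (dehn_proj G \<circ> (e \<circ> \<gamma>)) w"
      unfolding word_eval_def by (rule foldr_cong) (use w \<pi>_e in \<open>auto simp: words_def\<close>)
    also have "\<dots> = word_eval G \<gamma> []"
      unfolding \<pi>.hom_word_eval[OF e w(1), symmetric] w(2)[symmetric] z(2) by (simp add: word_eval_def)
    \<comment> \<open>This derivation is now replayed in \<open>D Mod T\<close>, where
      \<open>R\<close> holds by \<open>rel_T\<close>.\<close>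
    finally have "word_cong X R w []"
      using w by (intro presentation_word_cong[OF pres]) auto
    then have "word_eval (D Mod T) ((\<lambda>y. T #>\<^bsub>D\<^esub> y) \<circ> (e \<circ> \<gamma>)) w
        = word_eval (D Mod T) ((\<lambda>y. T #>\<^bsub>D\<^esub> y) \<circ> (e \<circ> \<gamma>)) []"
      by (rule q.H.word_eval_cong) (use q.hom_closed[OF e_closed] rel_T in \<open>simp_all add: Pi_iff\<close>)
    then have "T #>\<^bsub>D\<^esub> z = T"
      unfolding q.hom_word_eval[OF e w(1), symmetric] w(2)[symmetric]
      by (simp add: word_eval_def FactGroup_def)
    then show ?thesis using D.coset_join1[OF _ z(1) T] by simp
  qed

  \<comment> \<open>Injectivity of \<open>Ab\<close> on \<open>T\<close>\<close>
  \<comment> \<open>\<open>N\<close> is unspecified outside \<open>S\<close>, but the coefficient of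
    \<open>x\<close> there is 0.\<close>
  have Ab_h: "Poly_Mapping.lookup (Ab (h x)) \<O> = int (N \<O>) * Poly_Mapping.lookup x \<O>"
    if "Poly_Mapping.keys x \<subseteq> S" for x \<O>
    using that
  proof (induction x rule: free_Abelian_group_induct[consumes 1, case_names zero diff basis])
    case zero
    then show ?case using Ab.hom_one by (simp add: F_def h_zero)
  next
    case (diff x y)
    have xy: "Poly_Mapping.keys (x - y) \<subseteq> S" using diff keys_diff[of x y] by blast
    note * = h_K[OF diff(1)] h_K[OF diff(2)] h_K[OF xy]
    \<comment> \<open>Writing \<open>x\<close> as a sum makes additivity of \<open>h\<close> enough,
      with no inverses in \<open>D\<close>.\<close>
    have "h x = h (x - y) \<otimes>\<^bsub>D\<^esub> h y" using h_add[OF xy diff(2)] by simp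
    then have "Ab (h x) = Ab (h (x - y)) + Ab (h y)"
      using Ab.hom_mult[of "h (x - y)" "h y"] * subgroup.mem_carrier[OF K] by (simp add: F_def)
    then have "Ab (h (x - y)) = Ab (h x) - Ab (h y)" by simp
    then show ?case using diff by (simp add: lookup_minus right_diff_distrib)
  next
    case (basis \<O>')
    have p: "pow (A \<O>') (N \<O>')" "conj_class G (\<gamma> (A \<O>')) = \<O>'" using AN[OF basis] by auto
    then have "Ab (h (frag_of \<O>')) = frag_cmul (int (N \<O>')) (frag_of \<O>')"
      using h_of[OF basis] dehn_ab_fin_gen_pow[OF \<Gamma> _ pow_one[OF p(1)]]
      by (auto simp: Ab_def e_def D_def pow_def)
    then show ?case by (simp add: lookup_single when_def)
  qed
  \<comment> \<open>All coordinates of \<open>x\<close> vanish: in \<open>S\<close> because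
    \<open>Ab\<close> multiplies them by a nonzero \<open>N \<O>\<close>, elsewhere because
    \<open>x\<close> has no keys there.\<close>
  have Ab_inj: "z = \<one>\<^bsub>D\<^esub>" if z: "z \<in> K" "Ab z = 0" for z
  proof -
    obtain x where x: "Poly_Mapping.keys x \<subseteq> S" "z = h x"
      using K_T[OF z(1)] by (auto simp: T_def)
    have "Poly_Mapping.lookup x \<O> = 0" for \<O>
    proof (cases "\<O> \<in> S")
      case True
      then have "N \<O> \<noteq> 0" using AN by (fastforce simp: pow_def)
      then show ?thesis using Ab_h[OF x(1), of \<O>] z x by simp
    next
      case False
      then show ?thesis using x by (auto simp: in_keys_iff)
    qed
    then have "x = 0" by (intro poly_mapping_eqI) simp
    then show ?thesis using x h_zero by simp
  qed

  \<comment> \<open>The pairing of \<pi> and \<open>Ab\<close>\<close>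
  have hom: "(\<lambda>z. (dehn_proj G z, Ab z)) \<in> hom D (G \<times>\<times> F)"
    using \<pi>.homh Ab.homh by (simp add: hom_paired)
  \<comment> \<open>Injectivity is tested at the identity: a trivial first component puts
    \<open>z\<close> in \<open>K\<close>, and a trivial second one lets \<open>Ab_inj\<close>
    apply.\<close>
  moreover have "inj_on (\<lambda>z. (dehn_proj G z, Ab z)) (carrier D)"
    unfolding inj_on_one_iff'[OF hom D.is_group DirProd_group[OF is_group F.is_group]]
    using Ab_inj by (auto simp: K_def kernel_def F_def)
  ultimately show ?thesis by (simp add: D_def F_def Ab_def)
qed

end
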